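(* Consider the synchronous self-jamming singing protocol on a dynamic network, and let ${\cal E}_i$ denote the set of active edges in round $i$. Consider any arbitrary state of the protocol in round $i$. Then $$\mathbb{E}\big[|{\cal E}_{i+3}|\big] \le \tfrac{6}{7}\,|{\cal E}_i| + \tfrac{8}{7}\,|A_{i+3}\cup A_{i+2}\cup A_{i+1}|,$$ where the expectation is over the random $\ell$-values chosen in rounds $i$ and later.
   Context: Agents are the vertices of an undirected communication graph; agents know nothing about the graph. Each agent is in one of three states $\{\textsc{Out},\textsc{In},\textsc{Un}\}$ and operates in synchronous rounds (all rounds start and end simultaneously; every note sung in a round is heard by all neighbors by the end of the round). Self-jamming communication: an agent hears the union of notes sung by its neighbors except the notes it sings itself (presence only, not multiplicity). Self-jamming singing protocol (one round, agent in state $s$): compute a fresh $\ell$-value by flipping a fair coin until the first $0$, $\ell$ = number of flips (independent across agents and rounds). If $s=\textsc{Out}$: sing nothing, listen for note $0$. If $s=\textsc{In}$: sing even notes $0,2,\dots,2\ell-2$, listen for note $2\ell$. If $s=\textsc{Un}$: sing odd notes $1,3,\dots,2\ell-1$, listen for notes $0$ and $2\ell+1$. End of round: $\textsc{In}$ becomes $\textsc{Un}$ if it heard note $2\ell$, else stays $\textsc{In}$; $\textsc{Un}$ becomes $\textsc{Out}$ if it heard $0$, otherwise stays $\textsc{Un}$ if it heard $2\ell+1$ and becomes $\textsc{In}$ if not; $\textsc{Out}$ stays $\textsc{Out}$ if it heard $0$, else becomes $\textsc{Un}$. Dynamic networks: agents and edges may be inserted or deleted; all such changes are regarded as occurring at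 the beginning of a round; new agents start in arbitrary states. An agent that changes state arbitrarily or does not execute the protocol correctly at the end of round $i-1$ is modeled as being deleted and reinserted (with its edges) in its new state at the beginning of round $i$. An agent is changed in round $i$ if it is incident to an edge added or deleted at the beginning of round $i$. An edge is affected in round $i$ if one of its endpoints is at distance at most $2$ from an agent changed in round $i$; $A_i$ is the set of edges affected in round $i$. An agent is $\textsc{In}^{\overline{\textsc{In}}}$ in a round if it is $\textsc{In}$ and has no $\textsc{In}$ neighbor in that round. An agent is eliminated in round $i$ if it is $\textsc{In}^{\overline{\textsc{In}}}$ or adjacent to an $\textsc{In}^{\overline{\textsc{In}}}$ agent in round $i$; otherwise active. An edge is eliminated if some endpoint is eliminated, otherwise active. *)

theory Defs
  imports "HOL-Probability.Probability"
begin

text \<open>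
  The state called ``Un'' in the mathematical text is named \<open>Und\<close> here because \<open>Un\<close> is the ASCII
  syntax for set union.
\<close>

datatype state = Out | In | Und


section \<open>One round of the self-jamming singing protocol\<close>

text \<open>
  A network in one round is given by a finite agent set and a set of edges, each edge being a
  two-element set of agents.
\<close>

definition neighbors :: "'a set set \<Rightarrow> 'a \<Rightarrow> 'a set" where
  "neighbors E v = {w. {v, w} \<in> E}"

text \<open>
  The number of fair coin flips up to and including the first 0. The library's
  \<open>geometric_pmf\<close> counts only the flips before it.
\<close>

definition flips_pmf :: "nat pmf" where
  "flips_pmf = map_pmf Suc (geometric_pmf (1/2))"

definition ell_pmf :: "'a set \<Rightarrow> ('a \<Rightarrow> nat) pmf" where
  "ell_pmf V = Pi_pmf V 0 (\<lambda>_. flips_pmf)"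

fun sung :: "state \<Rightarrow> nat \<Rightarrow> nat set" where
  "sung Out l = {}"
| "sung In l = {2 * k | k. k < l}"
| "sung Und l = {2 * k + 1 | k. k < l}"

definition heard :: "'a set set \<Rightarrow> ('a \<Rightarrow> state) \<Rightarrow> ('a \<Rightarrow> nat) \<Rightarrow> 'a \<Rightarrow> nat set" where
  "heard E s l v = (\<Union>w\<in>neighbors E v. sung (s w) (l w)) - sung (s v) (l v)"

text \<open>
  The new state of an agent with \<open>\<ell>\<close>-value \<open>l\<close> that hears the set \<open>H\<close> of notes. The notes whose
  presence is tested are exactly the ones the agent listens for.
\<close>

fun transition :: "state \<Rightarrow> nat \<Rightarrow> nat set \<Rightarrow> state" where
  "transition Out l H = (if 0 \<in> H then Out else Und)"
| "transition In l H = (if 2 * l \<in> H then Und else In)"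
| "transition Und l H =
     (if 0 \<in> H then Out else if 2 * l + 1 \<in> H then Und else In)"

definition protocol_step ::
    "'a set set \<Rightarrow> ('a \<Rightarrow> state) \<Rightarrow> ('a \<Rightarrow> nat) \<Rightarrow> 'a \<Rightarrow> state" where
  "protocol_step E s l v = transition (s v) (l v) (heard E s l v)"


section \<open>Eliminated agents and active edges\<close>

definition lonely_In :: "'a set set \<Rightarrow> ('a \<Rightarrow> state) \<Rightarrow> 'a \<Rightarrow> bool" where
  "lonely_In E s v \<longleftrightarrow> s v = In \<and> (\<forall>w\<in>neighbors E v. s w \<noteq> In)"

definition eliminated :: "'a set set \<Rightarrow> ('a \<Rightarrow> state) \<Rightarrow> 'a \<Rightarrow> bool" where
  "eliminated E s v \<longleftrightarrow> lonely_In E s v \<or> (\<exists>w\<in>neighbors E v. lonely_In E s w)"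

definition active_edges :: "'a set set \<Rightarrow> ('a \<Rightarrow> state) \<Rightarrow> 'a set set" where
  "active_edges E s = {e \<in> E. \<forall>v\<in>e. \<not> eliminated E s v}"


section \<open>Dynamic networks\<close>

text \<open>
  \<open>V j\<close> and \<open>E j\<close> are the agents and edges during round \<open>j\<close>, after the changes made at the beginning
  of that round. \<open>R j\<close> is the set of agents that are deleted and reinserted at the beginning of
  round \<open>j\<close>; these occur both in the preceding round and in round \<open>j\<close>, so they are not visible
  from \<open>V\<close> and \<open>E\<close> alone.
\<close>

definition dynamic_network ::
    "(nat \<Rightarrow> 'a set) \<Rightarrow> (nat \<Rightarrow> 'a set set) \<Rightarrow> (nat \<Rightarrow> 'a set) \<Rightarrow> bool" where
  "dynamic_network V E R \<longleftrightarrow>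
     (\<forall>j. finite (V j)) \<and>
     (\<forall>j. \<forall>e\<in>E j. \<exists>u\<in>V j. \<exists>v\<in>V j. u \<noteq> v \<and> e = {u, v}) \<and>
     (\<forall>j. R (Suc j) \<subseteq> V j \<inter> V (Suc j))"

text \<open>
  In the following definitions \<open>j\<close> is meant to be positive, so that \<open>j - 1\<close> is the preceding
  round. All edges of a reinserted agent count as deleted (the old ones) and added (the new ones).
\<close>

definition inserted :: "(nat \<Rightarrow> 'a set) \<Rightarrow> (nat \<Rightarrow> 'a set) \<Rightarrow> nat \<Rightarrow> 'a set" where
  "inserted V R j = (V j - V (j - 1)) \<union> R j"

definition added_edges :: "(nat \<Rightarrow> 'a set set) \<Rightarrow> (nat \<Rightarrow> 'a set) \<Rightarrow> nat \<Rightarrow> 'a set set" where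
  "added_edges E R j = {e \<in> E j. e \<notin> E (j - 1) \<or> e \<inter> R j \<noteq> {}}"

definition deleted_edges :: "(nat \<Rightarrow> 'a set set) \<Rightarrow> (nat \<Rightarrow> 'a set) \<Rightarrow> nat \<Rightarrow> 'a set set" where
  "deleted_edges E R j = {e \<in> E (j - 1). e \<notin> E j \<or> e \<inter> R j \<noteq> {}}"

definition changed_agents :: "(nat \<Rightarrow> 'a set set) \<Rightarrow> (nat \<Rightarrow> 'a set) \<Rightarrow> nat \<Rightarrow> 'a set" where
  "changed_agents E R j = \<Union> (added_edges E R j \<union> deleted_edges E R j)"

definition dist_le :: "'a set set \<Rightarrow> nat \<Rightarrow> 'a \<Rightarrow> 'a \<Rightarrow> bool" where
  "dist_le E d u v \<longleftrightarrow> (\<exists>k\<le>d. (u, v) \<in> {(x, y). {x, y} \<in> E} ^^ k)"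

definition affected_edges :: "(nat \<Rightarrow> 'a set set) \<Rightarrow> (nat \<Rightarrow> 'a set) \<Rightarrow> nat \<Rightarrow> 'a set set" where
  "affected_edges E R j =
     {e \<in> E j. \<exists>u\<in>e. \<exists>c\<in>changed_agents E R j. dist_le (E j) 2 u c}"


section \<open>The protocol on a dynamic network\<close>

text \<open>
  \<open>run V E R new i s k\<close> is the joint distribution of the \<open>\<ell>\<close>-values of rounds \<open>i, \<dots>, i + k - 1\<close>
  (as a list, latest round first) and of the resulting states in round \<open>i + k\<close>, when \<open>s\<close> gives the
  states in round \<open>i\<close>. The state in round \<open>j\<close> of an agent inserted or reinserted at the beginning of
  round \<open>j\<close> is given by \<open>new j\<close>; it may depend on all \<open>\<ell>\<close>-values of the preceding rounds (and hence
  on all earlier states), but not on those of later rounds.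
\<close>

primrec run ::
    "(nat \<Rightarrow> 'a set) \<Rightarrow> (nat \<Rightarrow> 'a set set) \<Rightarrow> (nat \<Rightarrow> 'a set) \<Rightarrow>
     (nat \<Rightarrow> ('a \<Rightarrow> nat) list \<Rightarrow> 'a \<Rightarrow> state) \<Rightarrow> nat \<Rightarrow> ('a \<Rightarrow> state) \<Rightarrow> nat \<Rightarrow>
     (('a \<Rightarrow> nat) list \<times> ('a \<Rightarrow> state)) pmf" where
  "run V E R new i s 0 = return_pmf ([], s)"
| "run V E R new i s (Suc k) =
     bind_pmf (run V E R new i s k) (\<lambda>(h, t).
       map_pmf (\<lambda>l. (l # h,
           \<lambda>v. if v \<in> inserted V R (Suc (i + k)) then new (Suc (i + k)) (l # h) v
               else protocol_step (E (i + k)) t l v))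
         (ell_pmf (V (i + k))))"

end

theory Submission
  imports Defs
begin

text \<open>
  Only In agents, and Und agents without In neighbours, can be In in the next round; such an agent
  is In if its \<open>\<ell>\<close>-value is a weak maximum among its neighbours in the same state, and it is
  eliminated together with its neighbours if the maximum is strict. Incrementing the \<open>\<ell>\<close>-value of
  the first weak maximum in a given set of agents is injective, halves the probability and makes the
  maximum strict. Hence an edge that has an In agent in its closed neighbourhood after a round is
  eliminated in that round with at least half the probability of this event. An edge without such an agent
  both after the first and after the second round has two Und endpoints without In neighbours. For these
  edges the counting argument of Luby and of Metivier et al. shows that the third round
  eliminates in expectation at least a quarter as many edges. If \<open>x\<close> is the expected fraction of the
  edges eliminated after three rounds, then at most \<open>2 x\<close> have been near an In agent after the
  first two rounds, so \<open>x \<ge> (1 - 2 x) / 4\<close>, that is \<open>x \<ge> 1/6\<close>, which is even better than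
  \<open>1/7\<close>.

  Everything is local to distance 2, so an edge of the last graph that is not affected in any of
  the three rounds behaves as in a static network.
\<close>

section \<open>Maxima of the \<open>\<ell>\<close>-values\<close>

lemma integrable_pmf_bounded:
  fixes f :: "'a \<Rightarrow> real"
  assumes "\<And>x. \<bar>f x\<bar> \<le> B"
  shows "integrable (measure_pmf p) f"
  using assms by (intro measure_pmf.integrable_const_bound[where B = B]) auto

text \<open>A value n >= 1 has weight 2^-n, so raising it by one halves the weight exactly. The
  inequality covers the impossible cases, \<open>l v\<close> = 0 and \<open>l\<close> nonzero
  outside \<open>V\<close>, where the left side is 0.\<close>

lemma pmf_ell_raise:
  assumes "finite V" "v \<in> V"
  shows "pmf (ell_pmf V) l \<le> 2 * pmf (ell_pmf V) (l(v := Suc (l v)))"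
proof (cases "\<forall>x. x \<notin> V \<longrightarrow> l x = 0")
  case True
  have flip: "pmf flips_pmf n \<le> 2 * pmf flips_pmf (Suc n)" for n
  proof (cases n)
    case 0
    have "0 \<notin> set_pmf flips_pmf"
      by (auto simp: flips_pmf_def)
    then have "pmf flips_pmf 0 = 0"
      by (simp add: pmf_eq_0_set_pmf)
    then show ?thesis
      using 0 by simp
  next
    case (Suc m)
    have "pmf flips_pmf (Suc k) = (1 / 2) ^ Suc k" for k
      unfolding flips_pmf_def by (subst pmf_map_inj') auto
    then have "pmf flips_pmf (Suc m) = 2 * pmf flips_pmf (Suc (Suc m))"
      by (simp only: power_Suc)
    then show ?thesis
      using Suc by simp
  qed
  let ?rest = "\<Prod>x\<in>V - {v}. pmf flips_pmf (l x)"
  have split: "pmf (ell_pmf V) l' = pmf flips_pmf (l' v) * (\<Prod>x\<in>V - {v}. pmf flips_pmf (l' x))"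
    if "\<forall>x. x \<notin> V \<longrightarrow> l' x = 0" for l'
  proof -
    have "pmf (ell_pmf V) l' = (\<Prod>x\<in>V. pmf flips_pmf (l' x))"
      unfolding ell_pmf_def by (rule pmf_Pi'[OF assms(1)]) (use that in blast)
    also have "\<dots> = pmf flips_pmf (l' v) * (\<Prod>x\<in>V - {v}. pmf flips_pmf (l' x))"
      by (rule prod.remove[OF assms])
    finally show ?thesis .
  qed
  have "pmf (ell_pmf V) (l(v := Suc (l v))) = pmf flips_pmf (Suc (l v)) * ?rest"
    by (subst split) (use True assms in \<open>auto intro!: prod.cong\<close>)
  moreover have "pmf flips_pmf (l v) * ?rest \<le> (2 * pmf flips_pmf (Suc (l v))) * ?rest"
    by (intro mult_right_mono flip prod_nonneg) auto
  ultimately show ?thesis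
    using split[OF True] by (simp only: mult.assoc)
next
  case False
  have "pmf (ell_pmf V) l = 0"
    unfolding ell_pmf_def by (rule pmf_Pi_outside[OF assms(1)]) (use False in blast)
  then show ?thesis
    by simp
qed

text \<open>The function \<open>c\<close> selects the agent whose value is incremented; as the selection is still
  visible afterwards, the increment is injective.\<close>

lemma prob_ell_raise:
  fixes c :: "('a \<Rightarrow> nat) \<Rightarrow> 'a"
  assumes V: "finite V" and cV: "\<And>l. l \<in> W \<Longrightarrow> c l \<in> V"
    and T: "\<And>l. l \<in> W \<Longrightarrow> l(c l := Suc (l (c l))) \<in> T"
    and inv: "\<And>l. l \<in> W \<Longrightarrow> c (l(c l := Suc (l (c l)))) = c l"
  shows "measure_pmf.prob (ell_pmf V) W \<le> 2 * measure_pmf.prob (ell_pmf V) T"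
proof -
  let ?p = "ell_pmf V"
  let ?\<phi> = "\<lambda>l. l(c l := Suc (l (c l)))"
  have inj: "inj_on ?\<phi> W"
  proof (rule inj_onI)
    fix l l' assume W: "l \<in> W" "l' \<in> W" and eq: "?\<phi> l = ?\<phi> l'"
    then have c: "c l = c l'"
      using inv by metis
    show "l = l'"
    proof
      fix x show "l x = l' x"
        using fun_cong[OF eq, of x] c by (cases "x = c l") auto
    qed
  qed
  have summ: "Infinite_Set_Sum.abs_summable_on (\<lambda>l. pmf ?p (?\<phi> l)) W"
    using abs_summable_on_reindex_iff[OF inj, of "pmf ?p"] pmf_abs_summable by blast
  have "measure_pmf.prob ?p W = infsetsum (pmf ?p) W"
    by (rule measure_pmf_conv_infsetsum)
  also have "\<dots> \<le> infsetsum (\<lambda>l. 2 * pmf ?p (?\<phi> l)) W"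
  proof (rule infsetsum_mono)
    show "Infinite_Set_Sum.abs_summable_on (\<lambda>l. 2 * pmf ?p (?\<phi> l)) W"
      using summ by (auto intro!: Infinite_Set_Sum.abs_summable_on_cmult_right)
  qed (auto intro: pmf_ell_raise[OF V cV])
  also have "\<dots> = 2 * infsetsum (\<lambda>l. pmf ?p (?\<phi> l)) W"
    by (rule infsetsum_cmult_right)
       (use summ in auto)
  also have "infsetsum (\<lambda>l. pmf ?p (?\<phi> l)) W = infsetsum (pmf ?p) (?\<phi> ` W)"
    by (rule infsetsum_reindex[OF inj, symmetric])
  also have "\<dots> = measure_pmf.prob ?p (?\<phi> ` W)"
    by (rule measure_pmf_conv_infsetsum[symmetric])
  also have "\<dots> \<le> measure_pmf.prob ?p T"
    by (rule measure_pmf.finite_measure_mono) (use T in auto)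
  finally show ?thesis by simp
qed

text \<open>\<open>c l\<close> is the weak maximum of least rank. Raising it leaves it a weak
  maximum and creates no new one, so it is selected again, as \<open>prob_ell_raise\<close>
  requires.\<close>

lemma prob_strict_local_max:
  fixes N :: "'a \<Rightarrow> 'a set"
  assumes V: "finite V" and S: "S \<subseteq> V" and irrefl: "\<And>v. v \<notin> N v"
  shows "measure_pmf.prob (ell_pmf V) {l. \<exists>v\<in>S. \<forall>w\<in>N v. l w \<le> l v}
       \<le> 2 * measure_pmf.prob (ell_pmf V) {l. \<exists>v\<in>S. \<forall>w\<in>N v. l w < l v}"
proof -
  have finS: "finite S"
    using V S finite_subset by blast
  \<comment> \<open>An injective ranking decides among several weak maxima.\<close>
  obtain r :: "'a \<Rightarrow> nat" and n where r: "inj_on r S"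
    using finite_imp_inj_to_nat_seg[OF finS] by metis
  define M where "M l = {v \<in> S. \<forall>w\<in>N v. l w \<le> l v}" for l :: "'a \<Rightarrow> nat"
  define c where "c l = arg_min_on r (M l)" for l
  define raise where "raise l = l(c l := Suc (l (c l)))" for l
  have MS: "M l \<subseteq> S" for l
    by (auto simp: M_def)
  have finM: "finite (M l)" for l
    using MS finS finite_subset by blast
  have c: "c l \<in> M l" "\<And>v. v \<in> M l \<Longrightarrow> r (c l) \<le> r v" if "M l \<noteq> {}" for l
    using arg_min_if_finite(1)[OF finM that] arg_min_least[OF finM that] by (simp_all add: c_def)
  have raised_c: "c l \<in> M (raise l)" if "M l \<noteq> {}" for l
    using c(1)[OF that] unfolding M_def raise_def by (auto simp: le_SucI)
  \<comment> \<open>Raising \<open>c l\<close> only makes the condition harder for other agents, and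
    \<open>c l\<close> itself was in \<open>M l\<close> already.\<close>
  have raised_M: "M (raise l) \<subseteq> M l" if "M l \<noteq> {}" for l
  proof
    fix v assume v: "v \<in> M (raise l)"
    have "l w \<le> l v" if w: "w \<in> N v" for w
    proof (cases "v = c l")
      case True
      then show ?thesis
        using c(1)[OF \<open>M l \<noteq> {}\<close>] w by (simp add: M_def)
    next
      case False
      have "l w \<le> raise l w"
        by (simp add: raise_def)
      also have "\<dots> \<le> raise l v"
        using v w by (simp add: M_def)
      finally show ?thesis
        using False by (simp add: raise_def)
    qed
    then show "v \<in> M l"
      using v by (simp add: M_def)
  qed
  have "measure_pmf.prob (ell_pmf V) {l. M l \<noteq> {}}
      \<le> 2 * measure_pmf.prob (ell_pmf V) {l. \<exists>v\<in>S. \<forall>w\<in>N v. l w < l v}"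
  proof (rule prob_ell_raise[where c = c, OF V]; unfold raise_def[symmetric] mem_Collect_eq)
    fix l assume l: "M l \<noteq> {}"
    show "c l \<in> V"
      using c(1)[OF l] MS S by blast
    \<comment> \<open>\<open>c l\<close> is not in its own \<open>N (c l)\<close>, so its
      competitors keep their values while it gains one.\<close>
    have "\<forall>w\<in>N (c l). raise l w < raise l (c l)"
      using c(1)[OF l] irrefl[of "c l"] by (auto simp: M_def raise_def less_Suc_eq_le)
    then show "\<exists>v\<in>S. \<forall>w\<in>N v. raise l w < raise l v"
      using c(1)[OF l] MS by blast
    have l': "M (raise l) \<noteq> {}"
      using raised_c[OF l] by blast
    have "r (c (raise l)) = r (c l)"
      using c(2)[OF l' raised_c[OF l]] c(2)[OF l subsetD[OF raised_M[OF l] c(1)[OF l']]]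
      by (rule le_antisym)
    then show "c (raise l) = c l"
      using c(1)[OF l] c(1)[OF l'] MS by (intro inj_onD[OF r]) blast+
  qed
  moreover have "{l. M l \<noteq> {}} = {l. \<exists>v\<in>S. \<forall>w\<in>N v. l w \<le> l v}"
    by (auto simp: M_def)
  ultimately show ?thesis
    by simp
qed

text \<open>Transposing two members of \<open>M\<close> preserves the distribution, so all of them
  are maximal with equal probability. Some member is always maximal, hence these probabilities add
  up to at least 1; ties can make the sum larger.\<close>

lemma prob_max_ge:
  assumes V: "finite V" and M: "M \<subseteq> V" and v: "v \<in> M"
  shows "1 / real (card M) \<le> measure_pmf.prob (ell_pmf V) {l. \<forall>w\<in>M. l w \<le> l v}"
proof -
  let ?p = "ell_pmf V"
  let ?A = "\<lambda>v. {l :: 'a \<Rightarrow> nat. \<forall>w\<in>M. l w \<le> l v}"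
  have finM: "finite M"
    using V M finite_subset by blast
  have sym: "measure_pmf.prob ?p (?A u) = measure_pmf.prob ?p (?A v)" if u: "u \<in> M" for u
  proof -
    let ?h = "Transposition.transpose u v"
    have bij: "bij_betw ?h V V"
      using u v M by (intro bij_betw_transpose_iff) auto
    have perm: "?p = map_pmf (\<lambda>l. l \<circ> ?h) ?p"
      unfolding ell_pmf_def
      by (rule Pi_pmf_bij_betw[OF V bij]) (use u v M in \<open>auto simp: Transposition.transpose_def\<close>)
    have "measure_pmf.prob ?p (?A u) = measure_pmf.prob (map_pmf (\<lambda>l. l \<circ> ?h) ?p) (?A u)"
      by (simp only: perm[symmetric])
    also have "\<dots> = measure_pmf.prob ?p ((\<lambda>l. l \<circ> ?h) -` ?A u)"
      by (rule measure_map_pmf)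
    also have "(\<lambda>l. l \<circ> ?h) -` ?A u = ?A v"
    proof -
      have "(\<forall>w\<in>M. l (?h w) \<le> l v) \<longleftrightarrow> (\<forall>w\<in>M. l w \<le> l v)" for l :: "'a \<Rightarrow> nat"
      proof -
        have "?h ` M = M"
          using u v by (intro transpose_image_eq) simp
        then show ?thesis
          by (metis (no_types, lifting) image_iff)
      qed
      then show ?thesis
        by (auto simp: comp_def)
    qed
    finally show ?thesis .
  qed
  have "1 = measure_pmf.prob ?p (\<Union>u\<in>M. ?A u)"
  proof -
    have "(\<Union>u\<in>M. ?A u) = UNIV"
    proof -
      have "\<exists>u\<in>M. \<forall>w\<in>M. l w \<le> l u" for l :: "'a \<Rightarrow> nat"
      proof -
        have "Max (l ` M) \<in> l ` M"
          using finM v by (intro Max_in) auto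
        then obtain u where "u \<in> M" "l u = Max (l ` M)"
          by auto
        then show ?thesis
          using finM by (intro bexI[of _ u]) auto
      qed
      then show ?thesis by auto
    qed
    then show ?thesis by simp
  qed
  also have "\<dots> \<le> (\<Sum>u\<in>M. measure_pmf.prob ?p (?A u))"
    by (rule measure_pmf.finite_measure_subadditive_finite[OF finM]) auto
  also have "\<dots> = card M * measure_pmf.prob ?p (?A v)"
    using sym by simp
  finally have "1 \<le> card M * measure_pmf.prob ?p (?A v)" .
  moreover have "0 < real (card M)"
    using finM v by (auto simp: card_gt_0_iff)
  ultimately show ?thesis
    by (simp only: pos_divide_le_eq mult.commute)
qed

lemma prob_strict_max_ge:
  assumes V: "finite V" and M: "M \<subseteq> V" and v: "v \<in> M"
  shows "1 / (2 * real (card M)) \<le> measure_pmf.prob (ell_pmf V) {l. \<forall>w\<in>M - {v}. l w < l v}"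
proof -
  let ?p = "ell_pmf V"
  have "1 / real (card M) \<le> measure_pmf.prob ?p {l. \<forall>w\<in>M. l w \<le> l v}"
    by (rule prob_max_ge[OF V M v])
  \<comment> \<open>A single candidate with neighbourhood \<open>M - {u}\<close> makes the local
    maximum a maximum over \<open>M\<close>.\<close>
  also have "\<dots> \<le> measure_pmf.prob ?p {l. \<exists>u\<in>{v}. \<forall>w\<in>M - {u}. l w \<le> l u}"
    by (rule measure_pmf.finite_measure_mono) auto
  also have "\<dots> \<le> 2 * measure_pmf.prob ?p {l. \<exists>u\<in>{v}. \<forall>w\<in>M - {u}. l w < l u}"
    by (rule prob_strict_local_max[OF V]) (use M v in auto)
  also have "{l. \<exists>u\<in>{v}. \<forall>w\<in>M - {u}. l w < l u} = {l :: 'a \<Rightarrow> nat. \<forall>w\<in>M - {v}. l w < l v}"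
    by simp
  finally have "1 / real (card M) \<le> 2 * measure_pmf.prob ?p {l. \<forall>w\<in>M - {v}. l w < l v}" .
  moreover have "1 / (2 * real (card M)) = (1 / real (card M)) / 2"
    by simp
  ultimately show ?thesis
    by linarith
qed

section \<open>One round in an unchanged neighbourhood\<close>

definition simple_graph :: "'a set set \<Rightarrow> bool" where
  "simple_graph E \<longleftrightarrow> (\<forall>e\<in>E. \<exists>u v. u \<noteq> v \<and> e = {u, v})"

lemma neighbors_sym: "w \<in> neighbors E v \<longleftrightarrow> v \<in> neighbors E w"
  by (simp add: neighbors_def insert_commute)

lemma neighbors_irrefl: "simple_graph E \<Longrightarrow> v \<notin> neighbors E v"
  unfolding simple_graph_def neighbors_def by fastforce

lemma neighbors_Union:
  assumes "w \<in> neighbors E v"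
  shows "v \<in> \<Union>E" "w \<in> \<Union>E"
  using assms by (auto simp: neighbors_def)

text \<open>In agents sing even notes and Und agents odd ones, so only neighbours in the same state
  can sing the note just above an agent's own range.\<close>

definition rivals :: "'a set set \<Rightarrow> ('a \<Rightarrow> state) \<Rightarrow> 'a \<Rightarrow> 'a set" where
  "rivals E t v = {w \<in> neighbors E v. t w = t v}"

definition contender :: "'a set set \<Rightarrow> ('a \<Rightarrow> state) \<Rightarrow> 'a \<Rightarrow> bool" where
  "contender E t v \<longleftrightarrow> t v = In \<or> t v = Und \<and> (\<forall>w\<in>neighbors E v. t w \<noteq> In)"

definition touched :: "'a set set \<Rightarrow> ('a \<Rightarrow> state) \<Rightarrow> 'a set \<Rightarrow> bool" where
  "touched E t e \<longleftrightarrow> (\<exists>u\<in>e. \<exists>v\<in>insert u (neighbors E u). t v = In)"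

definition ready :: "'a set set \<Rightarrow> ('a \<Rightarrow> state) \<Rightarrow> 'a set \<Rightarrow> bool" where
  "ready E t e \<longleftrightarrow> (\<forall>u\<in>e. t u = Und \<and> (\<forall>w\<in>neighbors E u. t w \<noteq> In))"

section \<open>Notes heard and the resulting states\<close>

lemma sung_iff [simp]:
  "0 \<in> sung st l \<longleftrightarrow> st = In \<and> 0 < l"
  "2 * m \<in> sung st l \<longleftrightarrow> st = In \<and> m < l"
  "Suc (2 * m) \<in> sung st l \<longleftrightarrow> st = Und \<and> m < l"
  by (cases st; auto; presburger)+

lemma heard_zero_iff:
  "0 \<in> heard E t l v \<longleftrightarrow>
    (\<exists>w\<in>neighbors E v. t w = In \<and> 0 < l w) \<and> \<not> (t v = In \<and> 0 < l v)"
  by (auto simp: heard_def)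

text \<open>The note listened for is the first of its parity that the agent does not sing, so it
  never jams this note itself.\<close>

lemma heard_rival_iff:
  "t v = In \<Longrightarrow> 2 * l v \<in> heard E t l v \<longleftrightarrow> (\<exists>w\<in>rivals E t v. l v < l w)"
  "t v = Und \<Longrightarrow> Suc (2 * l v) \<in> heard E t l v \<longleftrightarrow> (\<exists>w\<in>rivals E t v. l v < l w)"
  by (auto simp: heard_def rivals_def)

text \<open>With positive values every In neighbour sings note 0, so an Und agent hears no 0 exactly
  if it has no In neighbour.\<close>

lemma protocol_step_In_iff:
  assumes "\<forall>w\<in>\<Union>E. 0 < l w"
  shows "protocol_step E t l v = In \<longleftrightarrow> contender E t v \<and> (\<forall>w\<in>rivals E t v. l w \<le> l v)"
proof -
  have "\<forall>w\<in>neighbors E v. 0 < l w"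
    using assms neighbors_Union(2) by fastforce
  then show ?thesis
    by (cases "t v")
      (auto simp: protocol_step_def contender_def heard_zero_iff heard_rival_iff not_le dest: leD)
qed

text \<open>Adjacent contenders are in the same state, because an Und contender has no In neighbour.
  If \<open>w\<close> became In, then \<open>v\<close> and \<open>w\<close> would be rivals, and
  \<open>w\<close> could not be below \<open>v\<close>.\<close>

lemma protocol_step_dominated:
  assumes pos: "\<forall>w\<in>\<Union>E. 0 < l w"
    and v: "contender E t v" "\<forall>w\<in>rivals E t v. l w < l v"
    and w: "w \<in> neighbors E v"
  shows "protocol_step E t l w \<noteq> In"
proof
  assume "protocol_step E t l w = In"
  then have w': "contender E t w" "\<forall>x\<in>rivals E t w. l x \<le> l w"
    using protocol_step_In_iff[OF pos] by blast+
  have "t w = t v"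
    using v(1) w'(1) w neighbors_sym[of w E v] unfolding contender_def by metis
  then have "w \<in> rivals E t v" "v \<in> rivals E t w"
    using w neighbors_sym[of w E v] by (auto simp: rivals_def)
  then show False
    using v(2) w'(2) by force
qed

lemma protocol_step_Out:
  assumes pos: "\<forall>w\<in>\<Union>E. 0 < l w"
    and "w \<in> neighbors E v" "t w = In" "t v \<noteq> In"
  shows "protocol_step E t l v = Out"
proof -
  have "0 \<in> heard E t l v"
    using assms bspec[OF pos neighbors_Union(2)[OF assms(2)]] by (auto simp: heard_zero_iff)
  then show ?thesis
    using assms(4) by (cases "t v") (auto simp: protocol_step_def)
qed

section \<open>Static behaviour within distance 2\<close>

definition ball2 :: "'a set set \<Rightarrow> 'a \<Rightarrow> 'a set" where
  "ball2 E u = insert u (neighbors E u \<union> (\<Union>v\<in>neighbors E u. neighbors E v))"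

text \<open>Whether \<open>u\<close> is eliminated depends on \<open>u\<close> or a neighbour being
  lonely, hence on agents up to distance 2. Nothing is assumed outside this ball, so the network may
  change arbitrarily there.\<close>

definition evolves :: "'a set set \<Rightarrow> 'a set set \<Rightarrow> ('a \<Rightarrow> state) \<Rightarrow> ('a \<Rightarrow> nat) \<Rightarrow> ('a \<Rightarrow> state) \<Rightarrow> 'a \<Rightarrow> bool" where
  "evolves E E' t l t' u \<longleftrightarrow>
     (\<forall>z\<in>ball2 E u. neighbors E' z = neighbors E z \<and> t' z = protocol_step E t l z)"

lemma evolvesD:
  assumes "evolves E E' t l t' u"
  shows "neighbors E' u = neighbors E u" "t' u = protocol_step E t l u"
    and "v \<in> neighbors E u \<Longrightarrow> neighbors E' v = neighbors E v"
    and "v \<in> neighbors E u \<Longrightarrow> t' v = protocol_step E t l v"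
    and "v \<in> neighbors E u \<Longrightarrow> w \<in> neighbors E v \<Longrightarrow> t' w = protocol_step E t l w"
  using assms unfolding evolves_def ball2_def by blast+

text \<open>\<open>v\<close> becomes In and \<open>protocol_step_dominated\<close> keeps its
  neighbours from doing so; the closed neighbourhood of \<open>v\<close> lies in the ball around
  \<open>u\<close>.\<close>

lemma strict_max_lonely:
  assumes pos: "\<forall>w\<in>\<Union>E. 0 < l w" and ev: "evolves E E' t l t' u"
    and v: "v \<in> insert u (neighbors E u)" "contender E t v" "\<forall>w\<in>rivals E t v. l w < l v"
  shows "lonely_In E' t' v"
proof -
  have "protocol_step E t l v = In"
    using v by (auto simp: protocol_step_In_iff[OF pos] less_imp_le)
  moreover have "neighbors E' v = neighbors E v" "t' v = protocol_step E t l v"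
    and "\<And>w. w \<in> neighbors E v \<Longrightarrow> t' w = protocol_step E t l w"
    using v(1) evolvesD[OF ev] by auto
  ultimately show ?thesis
    using protocol_step_dominated[OF pos v(2,3)] by (simp add: lonely_In_def)
qed

lemma strict_max_eliminated:
  assumes "\<forall>w\<in>\<Union>E. 0 < l w" and ev: "evolves E E' t l t' u"
    and v: "v \<in> insert u (neighbors E u)" and "contender E t v" "\<forall>w\<in>rivals E t v. l w < l v"
  shows "eliminated E' t' u"
  using strict_max_lonely[OF assms] v evolvesD(1)[OF ev] by (auto simp: eliminated_def)

lemma lonely_contender:
  assumes "lonely_In E t v"
  shows "contender E t v" "rivals E t v = {}"
  using assms by (auto simp: lonely_In_def contender_def rivals_def)

text \<open>A lonely In agent is a contender without rivals, hence vacuously a strict maximum, and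
  so it is lonely again.\<close>

lemma eliminated_persists:
  assumes "\<forall>w\<in>\<Union>E. 0 < l w" and "evolves E E' t l t' u" and "eliminated E t u"
  shows "eliminated E' t' u"
proof -
  obtain v where v: "v \<in> insert u (neighbors E u)" "lonely_In E t v"
    using assms(3) by (auto simp: eliminated_def)
  show ?thesis
    by (rule strict_max_eliminated[OF assms(1,2) v(1)]) (use lonely_contender[OF v(2)] in auto)
qed

lemma eliminated_touched: "u \<in> e \<Longrightarrow> eliminated E t u \<Longrightarrow> touched E t e"
  by (auto simp: eliminated_def touched_def lonely_In_def)

text \<open>Without In agents nearby the endpoints hear no 0 and cannot become Out; being untouched
  afterwards rules out In as well.\<close>

lemma untouched_twice_ready:
  assumes ev: "\<And>u. u \<in> e \<Longrightarrow> evolves E E' t l t' u"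
    and "\<not> touched E t e" "\<not> touched E' t' e"
  shows "ready E' t' e"
  unfolding ready_def
proof
  fix u assume u: "u \<in> e"
  have "t u \<noteq> In" "\<And>w. w \<in> neighbors E u \<Longrightarrow> t w \<noteq> In"
    using u assms(2) by (auto simp: touched_def)
  then have "protocol_step E t l u \<noteq> Out"
    by (cases "t u") (auto simp: protocol_step_def heard_zero_iff)
  moreover have "t' u \<noteq> In" "\<forall>w\<in>neighbors E' u. t' w \<noteq> In"
    using u assms(3) by (auto simp: touched_def)
  ultimately show "t' u = Und \<and> (\<forall>w\<in>neighbors E' u. t' w \<noteq> In)"
    using evolvesD(2)[OF ev[OF u]] by (cases "t' u") auto
qed

text \<open>Und agents eliminated at the start could compete with their neighbours without having
  active edges; they are gone after two rounds.\<close>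

lemma eliminated_not_Und_twice:
  assumes pos0: "\<forall>w\<in>\<Union>E0. 0 < l0 w" and ev0: "evolves E0 E1 t0 l0 t1 w"
    and pos1: "\<forall>w\<in>\<Union>E1. 0 < l1 w" and ev1: "evolves E1 E2 t1 l1 t2 w"
    and z: "z \<in> neighbors E0 w" "eliminated E0 t0 z"
  shows "t2 z \<noteq> Und"
proof -
  have N: "neighbors E1 z = neighbors E0 z" "t1 z = protocol_step E0 t0 l0 z"
    "z \<in> neighbors E1 w" "t2 z = protocol_step E1 t1 l1 z"
    using evolvesD[OF ev0] evolvesD[OF ev1] z(1) by auto
  obtain y where y: "y \<in> insert z (neighbors E0 z)" "lonely_In E0 t0 y"
    using z(2) by (auto simp: eliminated_def)
  show ?thesis
  proof (cases "y = z")
    case True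
    have "lonely_In E1 t1 z"
      by (rule strict_max_lonely[OF pos0 ev0]) (use z(1) y(2) True lonely_contender[of E0 t0 z] in auto)
    then have "protocol_step E1 t1 l1 z = In"
      using lonely_contender[of E1 t1 z] by (auto simp: protocol_step_In_iff[OF pos1])
    then show ?thesis
      using N by simp
  next
    case False
    then have yz: "y \<in> neighbors E0 z" "t0 y = In" "t0 z \<noteq> In"
      using y neighbors_sym[of y E0 z] by (auto simp: lonely_In_def)
    have "t1 z = Out"
      using protocol_step_Out[OF pos0 yz] N by simp
    \<comment> \<open>It is enough that \<open>y\<close> stays In. Its neighbours may be at distance
      3 from \<open>w\<close>, where \<open>ev0\<close> says nothing, so being lonely again is not
      claimed.\<close>
    moreover have "protocol_step E0 t0 l0 y = In"
      using lonely_contender[OF y(2)] by (auto simp: protocol_step_In_iff[OF pos0])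
    then have "t1 y = In"
      using evolvesD(5)[OF ev0 z(1) yz(1)] by simp
    ultimately have "protocol_step E1 t1 l1 z = Out"
      using yz(1) N(1) by (intro protocol_step_Out[OF pos1]) auto
    then show ?thesis
      using N by simp
  qed
qed

section \<open>Elimination probabilities\<close>

text \<open>Comparison on the support suffices. This gives access to the positivity of the values,
  which holds only there.\<close>

lemma prob_mono_support:
  assumes "\<And>x. x \<in> set_pmf p \<Longrightarrow> x \<in> A \<Longrightarrow> x \<in> B"
  shows "measure_pmf.prob p A \<le> measure_pmf.prob p B"
  by (rule measure_pmf.finite_measure_mono_AE) (auto simp: AE_measure_pmf_iff assms)

lemma expectation_mono_support:
  fixes f g :: "'a \<Rightarrow> real"
  assumes "\<And>x. x \<in> set_pmf p \<Longrightarrow> f x \<le> g x" "\<And>x. \<bar>f x\<bar> \<le> B" "\<And>x. \<bar>g x\<bar> \<le> C"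
  shows "measure_pmf.expectation p f \<le> measure_pmf.expectation p g"
  by (rule integral_mono_AE)
    (use assms(1) in \<open>auto simp: AE_measure_pmf_iff intro: integrable_pmf_bounded[OF assms(2)] integrable_pmf_bounded[OF assms(3)]\<close>)

lemma ell_pmf_pos:
  assumes "finite V" "l \<in> set_pmf (ell_pmf V)" "v \<in> V"
  shows "0 < l v"
proof -
  have "l v \<in> set_pmf flips_pmf"
    using set_Pi_pmf_subset'[OF assms(1)] assms(2,3) unfolding ell_pmf_def PiE_dflt_def
    by fastforce
  then show ?thesis
    by (auto simp: flips_pmf_def)
qed

text \<open>An In agent near \<open>e\<close> after the round was a weakly maximal contender near
  \<open>e\<close>, and a strictly maximal one eliminates an endpoint.
  \<open>prob_strict_local_max\<close> bridges the two at the cost of a factor 2.\<close>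

lemma prob_touched_le:
  assumes V: "finite V" and E: "simple_graph E" "\<Union>E \<subseteq> V" and e: "e \<in> E"
    and ev: "\<And>l u. u \<in> e \<Longrightarrow> evolves E E' t l (f l) u"
  shows "measure_pmf.prob (ell_pmf V) {l. touched E' (f l) e}
       \<le> 2 * measure_pmf.prob (ell_pmf V) {l. \<exists>u\<in>e. eliminated E' (f l) u}"
proof -
  define S where "S = {v. contender E t v \<and> (\<exists>u\<in>e. v \<in> insert u (neighbors E u))}"
  have pos: "\<forall>w\<in>\<Union>E. 0 < l w" if "l \<in> set_pmf (ell_pmf V)" for l
    using ell_pmf_pos[OF V that] E(2) by blast
  have "S \<subseteq> V"
    using e E(2) neighbors_Union(2) unfolding S_def by fastforce
  have "measure_pmf.prob (ell_pmf V) {l. touched E' (f l) e}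
      \<le> measure_pmf.prob (ell_pmf V) {l. \<exists>v\<in>S. \<forall>w\<in>rivals E t v. l w \<le> l v}"
  proof (rule prob_mono_support; unfold mem_Collect_eq)
    fix l assume l: "l \<in> set_pmf (ell_pmf V)" and "touched E' (f l) e"
    then obtain u v where u: "u \<in> e" "v \<in> insert u (neighbors E' u)" "f l v = In"
      by (auto simp: touched_def)
    have v: "v \<in> insert u (neighbors E u)" "f l v = protocol_step E t l v"
      using evolvesD[OF ev[OF u(1), of l]] u(2) by auto
    then have "contender E t v \<and> (\<forall>w\<in>rivals E t v. l w \<le> l v)"
      using u(3) protocol_step_In_iff[OF pos[OF l], of t v] by simp
    then show "\<exists>v\<in>S. \<forall>w\<in>rivals E t v. l w \<le> l v"
      using u(1) v(1) unfolding S_def by blast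
  qed
  also have "\<dots> \<le> 2 * measure_pmf.prob (ell_pmf V) {l. \<exists>v\<in>S. \<forall>w\<in>rivals E t v. l w < l v}"
    by (rule prob_strict_local_max[OF V \<open>S \<subseteq> V\<close>]) (simp add: rivals_def neighbors_irrefl[OF E(1)])
  also have "measure_pmf.prob (ell_pmf V) {l. \<exists>v\<in>S. \<forall>w\<in>rivals E t v. l w < l v}
      \<le> measure_pmf.prob (ell_pmf V) {l. \<exists>u\<in>e. eliminated E' (f l) u}"
  proof (rule prob_mono_support; unfold mem_Collect_eq)
    fix l assume l: "l \<in> set_pmf (ell_pmf V)" and "\<exists>v\<in>S. \<forall>w\<in>rivals E t v. l w < l v"
    then obtain u v where "u \<in> e" "v \<in> insert u (neighbors E u)" "contender E t v"
      "\<forall>w\<in>rivals E t v. l w < l v"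
      by (auto simp: S_def)
    then show "\<exists>u\<in>e. eliminated E' (f l) u"
      using strict_max_eliminated[OF pos[OF l] ev] by blast
  qed
  finally show ?thesis
    by simp
qed

section \<open>Counting eliminated edges by orientations\<close>

definition arcs :: "'a set set \<Rightarrow> ('a \<times> 'a) set" where
  "arcs E = {(v, w). {v, w} \<in> E}"

lemma arcs_swap: "(w, v) \<in> arcs E \<longleftrightarrow> (v, w) \<in> arcs E"
  by (simp add: arcs_def insert_commute)

lemma card_arcs:
  assumes "finite E" "simple_graph E"
  shows "finite (arcs E)" "card (arcs E) = 2 * card E"
proof -
  have fiber: "finite (arcs {e})" "card (arcs {e}) = 2" if "e \<in> E" for e
  proof -
    have "\<exists>u v. u \<noteq> v \<and> e = {u, v}"
      using assms(2) that by (simp add: simple_graph_def)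
    then obtain u v where uv: "u \<noteq> v" "e = {u, v}"
      by (elim exE conjE)
    have "arcs {e} = {(u, v), (v, u)}"
      unfolding uv(2) arcs_def by (auto simp: doubleton_eq_iff)
    then show "finite (arcs {e})" "card (arcs {e}) = 2"
      using uv(1) by simp_all
  qed
  have union: "arcs E = (\<Union>e\<in>E. arcs {e})"
    by (auto simp: arcs_def)
  show "finite (arcs E)"
    unfolding union using assms(1) fiber(1) by blast
  have "card (arcs E) = (\<Sum>e\<in>E. card (arcs {e}))"
    unfolding union using assms(1) fiber(1) by (intro card_UN_disjoint) (auto simp: arcs_def)
  then show "card (arcs E) = 2 * card E"
    using fiber(2) by simp
qed

text \<open>Each arc \<open>(v, w)\<close> of \<open>F\<close> for which \<open>v\<close> beats all rivals of \<open>v\<close> and of \<open>w\<close> eliminates \<open>w\<close>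
  and hence all arcs from \<open>w\<close> to its rivals. No \<open>w\<close> is counted twice, since two such \<open>v\<close> would
  be rivals of \<open>w\<close> and beat each other. The set \<open>L\<close> may be larger than \<open>F\<close> as the rivals count
  in the probability of winning even if their edges are not in \<open>F\<close>.\<close>

lemma expected_eliminated_ge:
  assumes V: "finite V" and E: "simple_graph E" "\<Union>E \<subseteq> V" and L: "finite L" "simple_graph L"
    and F: "F \<subseteq> E" "\<And>e. e \<in> F \<Longrightarrow> ready E t e"
    and ev: "\<And>l e u. e \<in> F \<Longrightarrow> u \<in> e \<Longrightarrow> evolves E E' t l (f l) u"
    and closed: "\<And>e w z. e \<in> F \<Longrightarrow> w \<in> e \<Longrightarrow> z \<in> neighbors E w \<Longrightarrow> t z = Und \<Longrightarrow> {w, z} \<in> L"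
  shows "real (card F) \<le> 4 * measure_pmf.expectation (ell_pmf V)
           (\<lambda>l. real (card {e \<in> L. \<exists>u\<in>e. eliminated E' (f l) u}))"
proof -
  let ?p = "ell_pmf V"
  define C where "C l = {e \<in> L. \<exists>u\<in>e. eliminated E' (f l) u}" for l
  define d where "d v = real (card (rivals E t v))" for v
  \<comment> \<open>\<open>v\<close> is removed from the union because it is itself a rival of
    \<open>w\<close>.\<close>
  define dom where "dom l v w \<longleftrightarrow> (\<forall>x\<in>(rivals E t v \<union> rivals E t w) - {v}. l x < l v)"
    for l :: "'a \<Rightarrow> nat" and v w
  have simpleF: "simple_graph F"
    using E(1) F(1) by (auto simp: simple_graph_def)
  have "finite E"
    using E(2) V by (meson finite_UnionD finite_subset)
  then have "finite F"
    using F(1) finite_subset by blast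
  note arcsF = card_arcs[OF \<open>finite F\<close> simpleF]
  have rivals_V: "rivals E t v \<subseteq> V" for v
    using neighbors_Union(2) E(2) unfolding rivals_def by fastforce
  then have fin_rivals: "finite (rivals E t v)" for v
    using V finite_subset by blast
  have arcD: "{v, w} \<in> F" "t v = Und" "t w = Und" "v \<in> rivals E t w" "w \<in> rivals E t v"
    "v \<noteq> w" "contender E t v" if "(v, w) \<in> arcs F" for v w
  proof -
    show F': "{v, w} \<in> F"
      using that by (simp add: arcs_def)
    have r: "t v = Und" "t w = Und" "\<forall>x\<in>neighbors E v. t x \<noteq> In"
      using F(2)[OF F'] by (auto simp: ready_def)
    then show "t v = Und" "t w = Und" "contender E t v"
      by (auto simp: contender_def)
    have N: "w \<in> neighbors E v"
      using F' F(1) by (auto simp: neighbors_def)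
    then show "v \<in> rivals E t w" "w \<in> rivals E t v"
      using r neighbors_sym[of w E v] by (auto simp: rivals_def)
    show "v \<noteq> w"
      using N neighbors_irrefl[OF E(1)] by blast
  qed
  have pos: "\<forall>w\<in>\<Union>E. 0 < l w" if "l \<in> set_pmf ?p" for l
    using ell_pmf_pos[OF V that] E(2) by blast
  \<comment> \<open>An arc \<open>(v, w)\<close> with \<open>dom l v w\<close> is charged to the
    \<open>d w\<close> arcs leaving \<open>w\<close> towards its rivals; the factor 2 is the number
    of orientations of an edge.\<close>
  have count: "(\<Sum>(v, w)\<in>arcs F. d w * indicator {l. dom l v w} l) \<le> 2 * real (card (C l))"
    if l: "l \<in> set_pmf ?p" for l
  proof -
    have finC: "finite (C l)" "simple_graph (C l)"
      using L by (auto simp: C_def simple_graph_def)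
    let ?D = "{(v, w) \<in> arcs F. dom l v w}"
    let ?T = "SIGMA (v, w) : ?D. rivals E t w"
    have "(\<Sum>(v, w)\<in>arcs F. d w * indicator {l. dom l v w} l) = (\<Sum>(v, w)\<in>?D. d w)"
      using arcsF(1) by (intro sum.mono_neutral_cong_right) (auto simp: indicator_def)
    also have "\<dots> = real (card ?T)"
      using arcsF(1) fin_rivals
      by (subst card_SigmaI) (auto intro!: finite_subset[of ?D "arcs F"] sum.cong simp: d_def split_beta)
    also have "card ?T \<le> card (arcs (C l))"
    proof (rule card_inj_on_le)
      show "finite (arcs (C l))"
        using card_arcs[OF finC] by simp
      show "inj_on (\<lambda>((v, w), z). (w, z)) ?T"
      proof (rule inj_onI, clarsimp)
        fix v v' w assume a: "(v, w) \<in> arcs F" "dom l v w" "(v', w) \<in> arcs F" "dom l v' w"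
        show "v = v'"
        proof (rule ccontr)
          assume "v \<noteq> v'"
          then have "l v < l v'" "l v' < l v"
            using a arcD(4)[OF a(1)] arcD(4)[OF a(3)] by (auto simp: dom_def)
          then show False by simp
        qed
      qed
      show "(\<lambda>((v, w), z). (w, z)) ` ?T \<subseteq> arcs (C l)"
      proof clarsimp
        fix v w z assume a: "(v, w) \<in> arcs F" "dom l v w" and z: "z \<in> rivals E t w"
        have "{w, z} \<in> L"
          using closed[OF arcD(1)[OF a(1)], of w z] z arcD(3)[OF a(1)] by (simp add: rivals_def)
        moreover have "eliminated E' (f l) w"
        proof (rule strict_max_eliminated[OF pos[OF l] ev[OF arcD(1)[OF a(1)]]])
          show "v \<in> insert w (neighbors E w)"
            using arcD(4)[OF a(1)] by (simp add: rivals_def)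
          show "\<forall>x\<in>rivals E t v. l x < l v"
            using a(2) neighbors_irrefl[OF E(1), of v] by (auto simp: dom_def rivals_def)
        qed (use arcD(7)[OF a(1)] in auto)
        ultimately show "(w, z) \<in> arcs (C l)"
          by (simp add: arcs_def C_def)
      qed
    qed
    also have "card (arcs (C l)) = 2 * card (C l)"
      by (rule card_arcs[OF finC])
    finally show ?thesis by simp
  qed
  \<comment> \<open>\<open>v\<close> has to win within a set of at most \<open>d v + d w\<close>
    agents.\<close>
  have weight: "d w / (2 * (d v + d w)) \<le> d w * measure_pmf.prob ?p {l. dom l v w}"
    if a: "(v, w) \<in> arcs F" for v w
  proof -
    let ?M = "rivals E t v \<union> rivals E t w"
    have "0 < card ?M"
      using arcD(4)[OF a] fin_rivals by (auto simp: card_gt_0_iff)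
    moreover have "real (card ?M) \<le> d v + d w"
      using card_Un_le[of "rivals E t v" "rivals E t w"] by (simp add: d_def)
    ultimately have "1 / (2 * (d v + d w)) \<le> 1 / (2 * real (card ?M))"
      by (intro divide_left_mono) auto
    also have "\<dots> \<le> measure_pmf.prob ?p {l. dom l v w}"
      unfolding dom_def
      by (rule prob_strict_max_ge[OF V]) (use rivals_V arcD(4)[OF a] in auto)
    finally have "d w * (1 / (2 * (d v + d w))) \<le> d w * measure_pmf.prob ?p {l. dom l v w}"
      by (rule mult_left_mono) (simp add: d_def)
    then show ?thesis by simp
  qed
  \<comment> \<open>Reversing all arcs exchanges \<open>d v\<close> and \<open>d w\<close>, and on
    each arc the two fractions add up to 1/2.\<close>
  have half: "(\<Sum>(v, w)\<in>arcs F. d w / (2 * (d v + d w))) = real (card F) / 2"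
  proof -
    have "(\<Sum>(v, w)\<in>arcs F. d w / (2 * (d v + d w))) = (\<Sum>(v, w)\<in>arcs F. d v / (2 * (d v + d w)))"
      by (rule sum.reindex_bij_witness[of _ prod.swap prod.swap])
        (auto simp: arcs_swap add.commute)
    moreover have "(\<Sum>(v, w)\<in>arcs F. d w / (2 * (d v + d w))) + (\<Sum>(v, w)\<in>arcs F. d v / (2 * (d v + d w)))
        = (\<Sum>a\<in>arcs F. 1 / 2)"
      unfolding sum.distrib[symmetric]
    proof (rule sum.cong[OF refl])
      fix a assume a: "a \<in> arcs F"
      obtain v w where vw: "a = (v, w)"
        by (cases a)
      have "0 < d v"
        using arcD(5)[of v w] a vw fin_rivals unfolding d_def by (auto simp: card_gt_0_iff)
      moreover have "0 \<le> d w"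
        by (simp add: d_def)
      ultimately show "(case a of (v, w) \<Rightarrow> d w / (2 * (d v + d w))) + (case a of (v, w) \<Rightarrow> d v / (2 * (d v + d w))) = 1 / 2"
        unfolding vw by (simp add: add_divide_distrib[symmetric] add.commute field_simps)
    qed
    ultimately show ?thesis
      using arcsF(2) by simp
  qed
  have int: "integrable (measure_pmf ?p) (\<lambda>l. d w * indicator {l. dom l v w} l)" for v w
    by (rule integrable_pmf_bounded[of _ "d w"]) (auto simp: indicator_def d_def)
  have "real (card F) / 2 \<le> (\<Sum>(v, w)\<in>arcs F. d w * measure_pmf.prob ?p {l. dom l v w})"
    unfolding half[symmetric] by (rule sum_mono) (use weight in auto)
  also have "\<dots> = measure_pmf.expectation ?p (\<lambda>l. \<Sum>(v, w)\<in>arcs F. d w * indicator {l. dom l v w} l)"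
    unfolding split_beta using int by (subst Bochner_Integration.integral_sum) auto
  also have "\<dots> \<le> measure_pmf.expectation ?p (\<lambda>l. 2 * real (card (C l)))"
  proof (rule expectation_mono_support)
    show "\<bar>2 * real (card (C l))\<bar> \<le> 2 * real (card L)" for l
      using card_mono[OF L(1), of "C l"] by (auto simp: C_def)
    show "\<bar>\<Sum>(v, w)\<in>arcs F. d w * indicator {l. dom l v w} l\<bar> \<le> (\<Sum>(v, w)\<in>arcs F. d w)" for l
      by (rule order_trans[OF sum_abs]) (auto intro!: sum_mono simp: indicator_def d_def)
  qed (rule count)
  finally show ?thesis
    by (simp add: C_def)
qed

section \<open>Unaffected edges\<close>

lemma dynamic_networkD:
  assumes "dynamic_network V E R"
  shows "finite (V j)" "simple_graph (E j)" "\<Union>(E j) \<subseteq> V j" "finite (E j)"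
proof -
  show V: "finite (V j)"
    using assms by (simp add: dynamic_network_def)
  have edge: "\<exists>u\<in>V j. \<exists>v\<in>V j. u \<noteq> v \<and> e = {u, v}" if "e \<in> E j" for e
    using assms that by (simp add: dynamic_network_def)
  show "simple_graph (E j)"
    unfolding simple_graph_def using edge by metis
  show E: "\<Union>(E j) \<subseteq> V j"
    using edge by fastforce
  show "finite (E j)"
    using finite_subset[OF E V] finite_UnionD by blast
qed

lemma ball2_dist_le:
  assumes "z \<in> ball2 E u"
  shows "dist_le E 2 u z"
proof -
  let ?r = "{(x, y). {x, y} \<in> E}"
  consider "z = u" | "(u, z) \<in> ?r" | v where "(u, v) \<in> ?r" "(v, z) \<in> ?r"
    using assms by (auto simp: ball2_def neighbors_def)
  then show ?thesis
  proof cases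
    case 1
    then show ?thesis
      unfolding dist_le_def by (intro exI[of _ 0]) simp
  next
    case 2
    then show ?thesis
      unfolding dist_le_def by (intro exI[of _ 1]) simp
  next
    case 3
    then have "(u, z) \<in> ?r ^^ 2"
      by (auto simp: numeral_2_eq_2)
    then show ?thesis
      unfolding dist_le_def by blast
  qed
qed

lemma ball2_incident:
  assumes "e \<in> E" "u \<in> e" "z \<in> ball2 E u"
  shows "z \<in> \<Union>E"
  using assms by (auto simp: ball2_def dest: neighbors_Union(2))

lemma neighbors_unchanged:
  assumes "z \<notin> changed_agents E R (Suc j)"
  shows "neighbors (E (Suc j)) z = neighbors (E j) z"
proof -
  have "e \<in> E (Suc j) \<longleftrightarrow> e \<in> E j" if "z \<in> e" for e
    using assms that by (auto simp: changed_agents_def added_edges_def deleted_edges_def)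
  then show ?thesis
    by (simp add: neighbors_def)
qed

text \<open>Changed agents are recognised by their edges only, so an inserted agent without edges
  would escape. An edge at \<open>z\<close> settles this: it was present before, with its ends in
  \<open>V j\<close>, and avoids \<open>R (Suc j)\<close>.\<close>

lemma not_inserted:
  assumes "dynamic_network V E R" "z \<notin> changed_agents E R (Suc j)" "z \<in> \<Union>(E (Suc j))"
  shows "z \<notin> inserted V R (Suc j)"
proof -
  obtain e where e: "e \<in> E (Suc j)" "z \<in> e"
    using assms(3) by blast
  then have "e \<in> E j" "e \<inter> R (Suc j) = {}"
    using assms(2) by (auto simp: changed_agents_def added_edges_def)
  then show ?thesis
    using e dynamic_networkD(3)[OF assms(1), of j] by (auto simp: inserted_def)
qed

text \<open>Being affected refers to distances in the new graph, whereas \<open>evolves\<close>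
  needs the ball in the old graph. Both balls agree, since \<open>u\<close> and its neighbours keep
  their neighbourhoods.\<close>

lemma unaffected_edge:
  assumes net: "dynamic_network V E R"
    and e: "e \<in> E (Suc j)" "e \<notin> affected_edges E R (Suc j)"
  shows "e \<in> E j"
    and "u \<in> e \<Longrightarrow> z \<in> ball2 (E j) u \<Longrightarrow>
      neighbors (E (Suc j)) z = neighbors (E j) z \<and> z \<notin> inserted V R (Suc j)"
proof -
  have calm: "z \<notin> changed_agents E R (Suc j)" if "u \<in> e" "z \<in> ball2 (E (Suc j)) u" for u z
    using e that ball2_dist_le unfolding affected_edges_def by fastforce
  obtain v where "v \<in> e"
    using e(1) dynamic_networkD(2)[OF net, of "Suc j"] by (auto simp: simple_graph_def)
  then show "e \<in> E j"
    using calm[of v v] e(1) by (auto simp: ball2_def changed_agents_def added_edges_def)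
  assume u: "u \<in> e" and z: "z \<in> ball2 (E j) u"
  have "neighbors (E (Suc j)) v = neighbors (E j) v" if "v \<in> insert u (neighbors (E (Suc j)) u)" for v
    by (rule neighbors_unchanged[OF calm[OF u]]) (use that in \<open>auto simp: ball2_def\<close>)
  then have "ball2 (E (Suc j)) u = ball2 (E j) u"
    unfolding ball2_def by auto
  then have z: "z \<in> ball2 (E (Suc j)) u"
    using z by simp
  show "neighbors (E (Suc j)) z = neighbors (E j) z \<and> z \<notin> inserted V R (Suc j)"
    using neighbors_unchanged[OF calm[OF u z]]
      not_inserted[OF net calm[OF u z] ball2_incident[OF e(1) u z]] ..
qed

section \<open>Expected progress of a single edge\<close>

definition edge_eliminated :: "'a set set \<Rightarrow> ('a \<Rightarrow> state) \<Rightarrow> 'a set \<Rightarrow> bool" where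
  "edge_eliminated E t e \<longleftrightarrow> (\<exists>u\<in>e. eliminated E t u)"

text \<open>An eliminated edge is touched and stays eliminated, so both 2s match. An untouched edge
  either becomes touched, with probability at most \<open>2 * ?elim\<close>, or becomes ready. For a
  touched edge that is not eliminated the left side is 0.\<close>

lemma expected_progress:
  assumes V: "finite V" and E: "simple_graph E" "\<Union>E \<subseteq> V" and e: "e \<in> E"
    and ev: "\<And>l u. u \<in> e \<Longrightarrow> evolves E E' t l (f l) u"
  shows "2 * of_bool (edge_eliminated E t e) + 1 - of_bool (touched E t e)
    \<le> 2 * measure_pmf.prob (ell_pmf V) {l. edge_eliminated E' (f l) e}
      + measure_pmf.prob (ell_pmf V) {l. ready E' (f l) e}"
    (is "_ \<le> 2 * ?elim + ?ready")
proof -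
  have "?elim = 1" if elim: "edge_eliminated E t e"
  proof -
    have "measure_pmf.prob (ell_pmf V) UNIV \<le> ?elim"
    proof (rule prob_mono_support)
      fix l assume "l \<in> set_pmf (ell_pmf V)"
      then have pos: "\<forall>w\<in>\<Union>E. 0 < l w"
        using ell_pmf_pos[OF V] E(2) by blast
      obtain u where "u \<in> e" "eliminated E t u"
        using elim by (auto simp: edge_eliminated_def)
      then show "l \<in> {l. edge_eliminated E' (f l) e}"
        using eliminated_persists[OF pos ev] by (auto simp: edge_eliminated_def)
    qed
    then show ?thesis
      using measure_pmf.prob_le_1[of "ell_pmf V" "{l. edge_eliminated E' (f l) e}"] by simp
  qed
  moreover have "1 \<le> 2 * ?elim + ?ready" if "\<not> touched E t e"
  proof -
    have "1 = measure_pmf.prob (ell_pmf V) ({l. touched E' (f l) e} \<union> {l. \<not> touched E' (f l) e})"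
      by (simp add: Collect_disj_eq[symmetric])
    also have "\<dots> \<le> measure_pmf.prob (ell_pmf V) {l. touched E' (f l) e}
        + measure_pmf.prob (ell_pmf V) {l. \<not> touched E' (f l) e}"
      by (rule measure_Un_le) auto
    also have "measure_pmf.prob (ell_pmf V) {l. touched E' (f l) e} \<le> 2 * ?elim"
      unfolding edge_eliminated_def by (rule prob_touched_le[OF V E e ev])
    also have "measure_pmf.prob (ell_pmf V) {l. \<not> touched E' (f l) e} \<le> ?ready"
      by (rule prob_mono_support) (use untouched_twice_ready[OF ev that] in auto)
    finally show ?thesis by simp
  qed
  moreover have "touched E t e" if "edge_eliminated E t e"
    using that by (auto simp: edge_eliminated_def intro: eliminated_touched)
  ultimately show ?thesis
    by (cases "touched E t e"; cases "edge_eliminated E t e") auto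
qed

section \<open>Expectations of bounded functions\<close>

lemma expectation_bounded:
  fixes f :: "'a \<Rightarrow> real"
  assumes "\<And>x. \<bar>f x\<bar> \<le> B"
  shows "\<bar>measure_pmf.expectation p f\<bar> \<le> B"
proof -
  have "\<bar>measure_pmf.expectation p f\<bar> \<le> measure_pmf.expectation p (\<lambda>x. \<bar>f x\<bar>)"
    by (rule integral_abs_bound)
  also have "\<dots> \<le> measure_pmf.expectation p (\<lambda>_. B)"
    by (rule integral_mono) (auto intro: integrable_pmf_bounded[of _ B] assms)
  finally show ?thesis by simp
qed

lemma expectation_bind_bounded:
  fixes f :: "'b \<Rightarrow> real"
  assumes "\<And>x. \<bar>f x\<bar> \<le> B"
  shows "measure_pmf.expectation (bind_pmf p q) f
    = measure_pmf.expectation p (\<lambda>x. measure_pmf.expectation (q x) f)"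
  unfolding measure_pmf_bind
proof (rule integral_bind[where K = "count_space UNIV" and B = B and B' = 1])
  show "(\<lambda>x. measure_pmf (q x)) \<in> measure_pmf p \<rightarrow>\<^sub>M subprob_algebra (count_space UNIV)"
    using measurable_measure_pmf[of q] by simp
  show "finite_measure (measure_pmf p)"
    by unfold_locales
qed (auto simp: assms measure_pmf.emeasure_eq_measure)

section \<open>Three rounds\<close>

text \<open>The common shape of the two potentials below, with coefficients 2, 1, 0 for eliminated
  and ready edges and 2, -1, 1 for eliminated and touched ones.\<close>

lemma expectation_sum_of_bool:
  fixes P Q :: "'a \<Rightarrow> 'b \<Rightarrow> bool" and \<alpha> \<beta> \<gamma> :: real
  shows "measure_pmf.expectation p (\<lambda>x. \<Sum>e\<in>G. \<alpha> * of_bool (P x e) + \<beta> * of_bool (Q x e) + \<gamma>)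
    = (\<Sum>e\<in>G. \<alpha> * measure_pmf.prob p {x. P x e} + \<beta> * measure_pmf.prob p {x. Q x e} + \<gamma>)"
proof -
  have ind: "(\<lambda>x. \<alpha> * of_bool (P x e) + \<beta> * of_bool (Q x e) + \<gamma>)
    = (\<lambda>x. \<alpha> * indicator {x. P x e} x + \<beta> * indicator {x. Q x e} x + \<gamma>)" for e
    by (simp add: indicator_def)
  have int: "integrable (measure_pmf p) (indicator A :: 'a \<Rightarrow> real)" for A
    by (rule integrable_pmf_bounded[of _ 1]) (auto simp: indicator_def)
  have "integrable (measure_pmf p) (\<lambda>x. \<alpha> * of_bool (P x e) + \<beta> * of_bool (Q x e) + \<gamma>)" for e
    unfolding ind by (intro Bochner_Integration.integrable_add integrable_mult_right int) simp
  moreover have "measure_pmf.expectation p (\<lambda>x. \<alpha> * of_bool (P x e) + \<beta> * of_bool (Q x e) + \<gamma>)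
    = \<alpha> * measure_pmf.prob p {x. P x e} + \<beta> * measure_pmf.prob p {x. Q x e} + \<gamma>" for e
    unfolding ind using int by simp
  ultimately show ?thesis
    by (simp add: Bochner_Integration.integral_sum)
qed

lemma abs_sum_of_bool_le:
  fixes \<alpha> \<beta> \<gamma> :: real
  shows "\<bar>\<Sum>e\<in>G. \<alpha> * of_bool (P e) + \<beta> * of_bool (Q e) + \<gamma>\<bar> \<le> real (card G) * (\<bar>\<alpha>\<bar> + \<bar>\<beta>\<bar> + \<bar>\<gamma>\<bar>)"
proof -
  have "\<bar>\<Sum>e\<in>G. \<alpha> * of_bool (P e) + \<beta> * of_bool (Q e) + \<gamma>\<bar> \<le> (\<Sum>e\<in>G. \<bar>\<alpha>\<bar> + \<bar>\<beta>\<bar> + \<bar>\<gamma>\<bar>)"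
    by (rule order_trans[OF sum_abs sum_mono]) (auto simp: of_bool_def)
  then show ?thesis
    by simp
qed

lemma card_filter_sum: "finite G \<Longrightarrow> real (card {e \<in> G. P e}) = (\<Sum>e\<in>G. of_bool (P e))"
  by (simp add: of_bool_def sum.If_cases Int_def)

lemma active_edges_iff: "e \<in> active_edges E t \<longleftrightarrow> e \<in> E \<and> \<not> edge_eliminated E t e"
  by (auto simp: active_edges_def edge_eliminated_def)

lemma edge_eliminated_persists:
  assumes "\<forall>w\<in>\<Union>E. 0 < l w" "\<And>u. u \<in> e \<Longrightarrow> evolves E E' t l t' u" "edge_eliminated E t e"
  shows "edge_eliminated E' t' e"
  using eliminated_persists[OF assms(1,2)] assms(3) by (auto simp: edge_eliminated_def)

theorem theorem2:
  fixes V :: "nat \<Rightarrow> 'a set" and E :: "nat \<Rightarrow> 'a set set" and R :: "nat \<Rightarrow> 'a set"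
    and new :: "nat \<Rightarrow> ('a \<Rightarrow> nat) list \<Rightarrow> 'a \<Rightarrow> state"
    and s :: "'a \<Rightarrow> state" and i :: nat
  assumes "dynamic_network V E R"
  shows "measure_pmf.expectation (run V E R new i s 3)
           (\<lambda>(h, t). real (card (active_edges (E (i + 3)) t)))
         \<le> 6 / 7 * real (card (active_edges (E i) s)) +
           8 / 7 * real (card (affected_edges E R (i + 3) \<union> affected_edges E R (i + 2)
                               \<union> affected_edges E R (i + 1)))"
proof -
  note net = dynamic_networkD[OF assms]
  let ?V0 = "V i" and ?V1 = "V (Suc i)" and ?V2 = "V (Suc (Suc i))"
  let ?E0 = "E i" and ?E1 = "E (Suc i)" and ?E2 = "E (Suc (Suc i))" and ?E3 = "E (Suc (Suc (Suc i)))"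
  let ?p0 = "ell_pmf ?V0" and ?p1 = "ell_pmf ?V1" and ?p2 = "ell_pmf ?V2"
  define A where "A = affected_edges E R (i + 3) \<union> affected_edges E R (i + 2) \<union> affected_edges E R (i + 1)"
  define K where "K = active_edges ?E0 s"
  define G where "G = K \<inter> ?E3 - A"
  \<comment> \<open>The history \<open>h\<close> influences only inserted agents, so the facts on
    unaffected edges below hold for every \<open>h\<close>.\<close>
  define nxt where "nxt k l h t = (\<lambda>v. if v \<in> inserted V R (Suc k) then new (Suc k) (l # h) v
      else protocol_step (E k) t l v)" for k l h t
  define s1 where "s1 l0 = nxt i l0 [] s" for l0
  define s2 where "s2 l0 l1 = nxt (Suc i) l1 [l0] (s1 l0)" for l0 l1
  define s3 where "s3 l0 l1 l2 = nxt (Suc (Suc i)) l2 [l1, l0] (s2 l0 l1)" for l0 l1 l2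
  define act where "act t = real (card (active_edges ?E3 t))" for t
  \<comment> \<open>The last summand is the error \<open>card (K \<inter> A)\<close> of the bound
    for ready edges, with its weight 2/3.\<close>
  define c where "c = real (card A) + real (card G) + 2 / 3 * real (card (K \<inter> A))"
  \<comment> \<open>As nested draws, the rounds can be averaged from the last to the first, with the
    earlier values fixed.\<close>
  have run: "run V E R new i s 3 = bind_pmf ?p0 (\<lambda>l0. bind_pmf ?p1 (\<lambda>l1.
      map_pmf (\<lambda>l2. ([l2, l1, l0], s3 l0 l1 l2)) ?p2))"
    unfolding s3_def s2_def s1_def nxt_def
    by (simp add: numeral_3_eq_3 map_pmf_def bind_assoc_pmf bind_return_pmf cong: if_cong)
  have act_bounded: "\<bar>act t\<bar> \<le> real (card ?E3)" for t
    using card_mono[OF net(4)] by (auto simp: act_def active_edges_def)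
  have expectation_run: "measure_pmf.expectation (run V E R new i s 3)
      (\<lambda>(h, t). real (card (active_edges (E (i + 3)) t)))
    = measure_pmf.expectation ?p0 (\<lambda>l0. measure_pmf.expectation ?p1 (\<lambda>l1.
        measure_pmf.expectation ?p2 (\<lambda>l2. act (s3 l0 l1 l2))))"
  proof -
    have "(\<lambda>(h :: ('a \<Rightarrow> nat) list, t). real (card (active_edges (E (i + 3)) t))) = (\<lambda>x. act (snd x))"
      by (auto simp: act_def numeral_3_eq_3)
    then show ?thesis
      unfolding run by (simp add: expectation_bind_bounded[OF act_bounded])
  qed

  have finK: "finite K" and finG: "finite G" and finA: "finite A"
    using net(4) by (auto simp: K_def G_def A_def active_edges_def affected_edges_def)
  \<comment> \<open>An edge of the last graph outside \<open>A\<close> is traced backwards: being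
    unaffected in a round, it was present in the preceding one.\<close>
  have edge: "e \<in> ?E2" "e \<in> ?E1" "e \<in> ?E0"
    and evolve0: "\<And>u t l h. u \<in> e \<Longrightarrow> evolves ?E0 ?E1 t l (nxt i l h t) u"
    and evolve1: "\<And>u t l h. u \<in> e \<Longrightarrow> evolves ?E1 ?E2 t l (nxt (Suc i) l h t) u"
    and evolve2: "\<And>u t l h. u \<in> e \<Longrightarrow> evolves ?E2 ?E3 t l (nxt (Suc (Suc i)) l h t) u"
    if e: "e \<in> ?E3" "e \<notin> A" for e
  proof -
    have unaff: "e \<notin> affected_edges E R (Suc i)" "e \<notin> affected_edges E R (Suc (Suc i))"
      "e \<notin> affected_edges E R (Suc (Suc (Suc i)))"
      using e(2) by (auto simp: A_def numeral_3_eq_3 numeral_2_eq_2)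
    show e2: "e \<in> ?E2"
      by (rule unaffected_edge(1)[OF assms e(1) unaff(3)])
    show e1: "e \<in> ?E1"
      by (rule unaffected_edge(1)[OF assms e2 unaff(2)])
    show "e \<in> ?E0"
      by (rule unaffected_edge(1)[OF assms e1 unaff(1)])
    show "evolves ?E0 ?E1 t l (nxt i l h t) u" if "u \<in> e" for u t l h
      using unaffected_edge(2)[OF assms e1 unaff(1) that] by (simp add: evolves_def nxt_def)
    show "evolves ?E1 ?E2 t l (nxt (Suc i) l h t) u" if "u \<in> e" for u t l h
      using unaffected_edge(2)[OF assms e2 unaff(2) that] by (simp add: evolves_def nxt_def)
    show "evolves ?E2 ?E3 t l (nxt (Suc (Suc i)) l h t) u" if "u \<in> e" for u t l h
      using unaffected_edge(2)[OF assms e(1) unaff(3) that] by (simp add: evolves_def nxt_def)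
  qed
  have GD: "e \<in> ?E3" "e \<notin> A" "e \<in> K" if "e \<in> G" for e
    using that by (auto simp: G_def)
  have pos: "\<forall>w\<in>\<Union>(E j). 0 < l w" if "l \<in> set_pmf (ell_pmf (V j))" for l j
    using ell_pmf_pos[OF net(1) that] net(3) by blast

  \<comment> \<open>A combination, with weights 1/3 and 2/3, of two lower bounds for the expected number of
    eliminated edges of \<open>G\<close>: the number already eliminated, and the bound for the ready edges.\<close>
  have round2: "measure_pmf.expectation ?p2 (\<lambda>l2. act (s3 l0 l1 l2))
      \<le> c - (\<Sum>e\<in>G. 2 * of_bool (edge_eliminated ?E2 (s2 l0 l1) e)
              + 1 * of_bool (ready ?E2 (s2 l0 l1) e) + 0) / 6"
    if l0: "l0 \<in> set_pmf ?p0" and l1: "l1 \<in> set_pmf ?p1" for l0 l1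
  proof -
    let ?t = "s2 l0 l1"
    let ?X = "\<lambda>l2. real (card {e \<in> G. edge_eliminated ?E3 (s3 l0 l1 l2) e})"
    \<comment> \<open>An endpoint of a ready edge may have rivals across affected edges, so the
      edges charged by the count need not lie in \<open>G\<close>.\<close>
    let ?L = "K \<inter> ?E3"
    let ?Y = "\<lambda>l2. real (card {e \<in> ?L. \<exists>u\<in>e. eliminated ?E3 (s3 l0 l1 l2) u})"
    define F where "F = {e \<in> G. ready ?E2 ?t e}"
    have X_bounded: "\<bar>?X l2\<bar> \<le> real (card G)" for l2
      using card_mono[OF finG, of "{e \<in> G. edge_eliminated ?E3 (s3 l0 l1 l2) e}"] by auto
    have X_int: "integrable (measure_pmf ?p2) ?X"
      by (rule integrable_pmf_bounded[OF X_bounded])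
    \<comment> \<open>By persistence, an edge outside \<open>A\<close> that is active at the end was
      active at the start, so it belongs to \<open>G\<close>.\<close>
    have act_le: "act (s3 l0 l1 l2) \<le> real (card A) + real (card G) - ?X l2"
      if l2: "l2 \<in> set_pmf ?p2" for l2
    proof -
      let ?D = "{e \<in> G. edge_eliminated ?E3 (s3 l0 l1 l2) e}"
      have "active_edges ?E3 (s3 l0 l1 l2) \<subseteq> A \<union> (G - ?D)"
      proof
        fix e assume "e \<in> active_edges ?E3 (s3 l0 l1 l2)"
        then have e: "e \<in> ?E3" "\<not> edge_eliminated ?E3 (s3 l0 l1 l2) e"
          by (simp_all add: active_edges_iff)
        show "e \<in> A \<union> (G - ?D)"
        proof (cases "e \<in> A")
          case False
          note unaff = e(1) False
          have "\<not> edge_eliminated ?E2 ?t e"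
            using e(2) edge_eliminated_persists[OF pos[OF l2] evolve2[OF unaff]]
            unfolding s3_def by blast
          then have "\<not> edge_eliminated ?E1 (s1 l0) e"
            using edge_eliminated_persists[OF pos[OF l1] evolve1[OF unaff]]
            unfolding s2_def by blast
          then have "\<not> edge_eliminated ?E0 s e"
            using edge_eliminated_persists[OF pos[OF l0] evolve0[OF unaff]]
            unfolding s1_def by blast
          then have "e \<in> K"
            using edge(3)[OF unaff] by (simp add: K_def active_edges_iff)
          then show ?thesis
            using e False by (simp add: G_def)
        qed simp
      qed
      then have "card (active_edges ?E3 (s3 l0 l1 l2)) \<le> card (A \<union> (G - ?D))"
        using finA finG by (intro card_mono) auto
      also have "\<dots> \<le> card A + card (G - ?D)"
        by (rule card_Un_le)
      also have "card (G - ?D) = card G - card ?D"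
        using finG by (intro card_Diff_subset) auto
      finally show ?thesis
        using card_mono[OF finG, of ?D] by (simp add: act_def)
    qed
    have "measure_pmf.expectation ?p2 (\<lambda>l2. act (s3 l0 l1 l2))
        \<le> measure_pmf.expectation ?p2 (\<lambda>l2. real (card A) + real (card G) - ?X l2)"
    proof (rule expectation_mono_support[OF act_le act_bounded])
      show "\<bar>real (card A) + real (card G) - ?X l2\<bar> \<le> real (card A) + real (card G)" for l2
        using X_bounded[of l2] by simp
    qed
    also have "\<dots> = real (card A) + real (card G) - measure_pmf.expectation ?p2 ?X"
      using X_int by simp
    finally have act: "measure_pmf.expectation ?p2 (\<lambda>l2. act (s3 l0 l1 l2))
        \<le> real (card A) + real (card G) - measure_pmf.expectation ?p2 ?X" .
    have "measure_pmf.expectation ?p2 (\<lambda>_. real (card {e \<in> G. edge_eliminated ?E2 ?t e}))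
        \<le> measure_pmf.expectation ?p2 ?X"
    proof (rule expectation_mono_support[OF _ _ X_bounded])
      fix l2 assume l2: "l2 \<in> set_pmf ?p2"
      have "{e \<in> G. edge_eliminated ?E2 ?t e} \<subseteq> {e \<in> G. edge_eliminated ?E3 (s3 l0 l1 l2) e}"
      proof safe
        fix e assume e: "e \<in> G" "edge_eliminated ?E2 ?t e"
        show "edge_eliminated ?E3 (s3 l0 l1 l2) e"
          unfolding s3_def
          by (rule edge_eliminated_persists[OF pos[OF l2] evolve2[OF GD(1,2)[OF e(1)]] e(2)])
      qed
      then show "real (card {e \<in> G. edge_eliminated ?E2 ?t e}) \<le> ?X l2"
        using finG by (intro of_nat_mono card_mono) auto
    qed auto
    then have X1: "(\<Sum>e\<in>G. of_bool (edge_eliminated ?E2 ?t e)) \<le> measure_pmf.expectation ?p2 ?X"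
      using card_filter_sum[OF finG] by simp
    have "real (card F) \<le> 4 * measure_pmf.expectation ?p2 ?Y"
    proof (rule expected_eliminated_ge[OF net(1) net(2) net(3)])
      show "F \<subseteq> ?E2"
        using edge(1)[OF GD(1,2)] by (auto simp: F_def)
      show "finite ?L"
        using finK by simp
      show "simple_graph ?L"
        using net(2)[of i] by (auto simp: simple_graph_def K_def active_edges_def)
      show "ready ?E2 ?t e" if "e \<in> F" for e
        using that by (simp add: F_def)
      show "evolves ?E2 ?E3 ?t l2 (s3 l0 l1 l2) u" if "e \<in> F" "u \<in> e" for l2 e u
        unfolding s3_def by (rule evolve2[OF GD(1,2)]) (use that in \<open>auto simp: F_def\<close>)
      \<comment> \<open>An Und neighbour after two rounds was not eliminated initially, so its edge
        to \<open>w\<close> started out active.\<close>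
      show "{w, z} \<in> ?L"
        if e: "e \<in> F" and w: "w \<in> e" and z: "z \<in> neighbors ?E2 w" "?t z = Und" for e w z
      proof -
        have "e \<in> G"
          using e by (simp add: F_def)
        note e' = GD[OF this]
        note ev0 = evolve0[OF e'(1,2) w, of s l0 "[]", folded s1_def]
        note ev1 = evolve1[OF e'(1,2) w, of "s1 l0" l1 "[l0]", folded s2_def]
        have "neighbors ?E1 w = neighbors ?E0 w" "neighbors ?E2 w = neighbors ?E1 w"
          "neighbors ?E3 w = neighbors ?E2 w"
          using evolvesD(1)[OF ev0] evolvesD(1)[OF ev1] evolvesD(1)[OF evolve2[OF e'(1,2) w]] by auto
        then have N: "z \<in> neighbors ?E0 w" "z \<in> neighbors ?E3 w"
          using z(1) by auto
        have "\<not> eliminated ?E0 s z"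
          using eliminated_not_Und_twice[OF pos[OF l0] ev0 pos[OF l1] ev1 N(1)] z(2) by blast
        moreover have "\<not> eliminated ?E0 s w"
          using e'(3) w by (auto simp: K_def active_edges_def)
        ultimately show ?thesis
          using N by (auto simp: K_def active_edges_def neighbors_def)
      qed
    qed
    \<comment> \<open>The edges of \<open>?L\<close> outside \<open>G\<close> all lie in
      \<open>K \<inter> A\<close>.\<close>
    also have "measure_pmf.expectation ?p2 ?Y \<le> measure_pmf.expectation ?p2 (\<lambda>l2. ?X l2 + real (card (K \<inter> A)))"
    proof (rule expectation_mono_support)
      fix l2
      have "{e \<in> ?L. \<exists>u\<in>e. eliminated ?E3 (s3 l0 l1 l2) u}
          \<subseteq> {e \<in> G. edge_eliminated ?E3 (s3 l0 l1 l2) e} \<union> K \<inter> A"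
        by (auto simp: G_def edge_eliminated_def)
      then have "card {e \<in> ?L. \<exists>u\<in>e. eliminated ?E3 (s3 l0 l1 l2) u}
          \<le> card ({e \<in> G. edge_eliminated ?E3 (s3 l0 l1 l2) e} \<union> K \<inter> A)"
        using finG finK by (intro card_mono) auto
      also have "\<dots> \<le> card {e \<in> G. edge_eliminated ?E3 (s3 l0 l1 l2) e} + card (K \<inter> A)"
        by (rule card_Un_le)
      finally show "?Y l2 \<le> ?X l2 + real (card (K \<inter> A))"
        by simp
      show "\<bar>?Y l2\<bar> \<le> real (card K)" for l2
        using finK by (auto intro!: card_mono)
      show "\<bar>?X l2 + real (card (K \<inter> A))\<bar> \<le> real (card G) + real (card (K \<inter> A))" for l2
        using X_bounded[of l2] by simp
    qed
    also have "\<dots> = measure_pmf.expectation ?p2 ?X + real (card (K \<inter> A))"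
      using X_int by simp
    finally have "real (card F) \<le> 4 * (measure_pmf.expectation ?p2 ?X + real (card (K \<inter> A)))"
      by simp
    then have X2: "(\<Sum>e\<in>G. of_bool (ready ?E2 ?t e)) \<le> 4 * (measure_pmf.expectation ?p2 ?X + real (card (K \<inter> A)))"
      using card_filter_sum[OF finG, of "ready ?E2 ?t"] by (simp add: F_def)
    have sum: "(\<Sum>e\<in>G. 2 * of_bool (edge_eliminated ?E2 ?t e) + 1 * of_bool (ready ?E2 ?t e) + 0)
        = 2 * (\<Sum>e\<in>G. of_bool (edge_eliminated ?E2 ?t e)) + (\<Sum>e\<in>G. of_bool (ready ?E2 ?t e) :: real)"
      by (simp add: sum.distrib sum_distrib_left)
    show ?thesis
      using act X1 X2 unfolding sum c_def by argo
  qed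

  \<comment> \<open>Averaging over the middle round replaces the potential of eliminated and ready
    edges by the left side of \<open>expected_progress\<close>.\<close>
  have round1: "measure_pmf.expectation ?p1 (\<lambda>l1. measure_pmf.expectation ?p2 (\<lambda>l2. act (s3 l0 l1 l2)))
      \<le> c - (\<Sum>e\<in>G. 2 * of_bool (edge_eliminated ?E1 (s1 l0) e)
              + (- 1) * of_bool (touched ?E1 (s1 l0) e) + 1) / 6"
    if l0: "l0 \<in> set_pmf ?p0" for l0
  proof -
    let ?Z = "\<lambda>l1. \<Sum>e\<in>G. 2 * of_bool (edge_eliminated ?E2 (s2 l0 l1) e)
              + 1 * of_bool (ready ?E2 (s2 l0 l1) e) + 0 :: real"
    have Z_bounded: "\<bar>?Z l1\<bar> \<le> real (card G) * (\<bar>2\<bar> + \<bar>1\<bar> + \<bar>0\<bar>)" for l1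
      by (rule abs_sum_of_bool_le)
    have Z_int: "integrable (measure_pmf ?p1) ?Z"
      by (rule integrable_pmf_bounded[OF Z_bounded])
    have "measure_pmf.expectation ?p1 (\<lambda>l1. measure_pmf.expectation ?p2 (\<lambda>l2. act (s3 l0 l1 l2)))
        \<le> measure_pmf.expectation ?p1 (\<lambda>l1. c - ?Z l1 / 6)"
    proof (rule expectation_mono_support[OF round2[OF l0] expectation_bounded[OF act_bounded]])
      show "\<bar>c - ?Z l1 / 6\<bar> \<le> \<bar>c\<bar> + real (card G) * (\<bar>2\<bar> + \<bar>1\<bar> + \<bar>0\<bar>)" for l1
        using Z_bounded[of l1] by linarith
    qed
    also have "\<dots> = c - measure_pmf.expectation ?p1 ?Z / 6"
      using Z_int by simp
    also have "measure_pmf.expectation ?p1 ?Z = (\<Sum>e\<in>G. 2 * measure_pmf.prob ?p1 {l1. edge_eliminated ?E2 (s2 l0 l1) e}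
              + 1 * measure_pmf.prob ?p1 {l1. ready ?E2 (s2 l0 l1) e} + 0)"
      by (rule expectation_sum_of_bool)
    finally have *: "measure_pmf.expectation ?p1 (\<lambda>l1. measure_pmf.expectation ?p2 (\<lambda>l2. act (s3 l0 l1 l2)))
        \<le> c - (\<Sum>e\<in>G. 2 * measure_pmf.prob ?p1 {l1. edge_eliminated ?E2 (s2 l0 l1) e}
              + 1 * measure_pmf.prob ?p1 {l1. ready ?E2 (s2 l0 l1) e} + 0) / 6" .
    have "(\<Sum>e\<in>G. 2 * of_bool (edge_eliminated ?E1 (s1 l0) e) + (- 1) * of_bool (touched ?E1 (s1 l0) e) + 1)
        \<le> (\<Sum>e\<in>G. 2 * measure_pmf.prob ?p1 {l1. edge_eliminated ?E2 (s2 l0 l1) e}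
              + 1 * measure_pmf.prob ?p1 {l1. ready ?E2 (s2 l0 l1) e} + 0)"
    proof (rule sum_mono)
      fix e assume e: "e \<in> G"
      note e' = GD(1,2)[OF e]
      show "2 * of_bool (edge_eliminated ?E1 (s1 l0) e) + (- 1) * of_bool (touched ?E1 (s1 l0) e) + 1
        \<le> 2 * measure_pmf.prob ?p1 {l1. edge_eliminated ?E2 (s2 l0 l1) e}
              + 1 * measure_pmf.prob ?p1 {l1. ready ?E2 (s2 l0 l1) e} + 0"
        using expected_progress[OF net(1) net(2) net(3) edge(2)[OF e']
            evolve1[OF e', where t = "s1 l0" and h = "[l0]", folded s2_def]]
        by linarith
    qed
    then show ?thesis
      using * by linarith
  qed

  \<comment> \<open>By \<open>prob_touched_le\<close>, the expected potential is at least 1 for each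
    edge of \<open>G\<close>.\<close>
  have round0: "measure_pmf.expectation ?p0 (\<lambda>l0. measure_pmf.expectation ?p1 (\<lambda>l1.
        measure_pmf.expectation ?p2 (\<lambda>l2. act (s3 l0 l1 l2)))) \<le> c - real (card G) / 6"
  proof -
    let ?Z = "\<lambda>l0. \<Sum>e\<in>G. 2 * of_bool (edge_eliminated ?E1 (s1 l0) e)
              + (- 1) * of_bool (touched ?E1 (s1 l0) e) + 1 :: real"
    have Z_bounded: "\<bar>?Z l0\<bar> \<le> real (card G) * (\<bar>2\<bar> + \<bar>- 1\<bar> + \<bar>1\<bar>)" for l0
      by (rule abs_sum_of_bool_le)
    have Z_int: "integrable (measure_pmf ?p0) ?Z"
      by (rule integrable_pmf_bounded[OF Z_bounded])
    have "measure_pmf.expectation ?p0 (\<lambda>l0. measure_pmf.expectation ?p1 (\<lambda>l1.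
        measure_pmf.expectation ?p2 (\<lambda>l2. act (s3 l0 l1 l2))))
        \<le> measure_pmf.expectation ?p0 (\<lambda>l0. c - ?Z l0 / 6)"
    proof (rule expectation_mono_support[OF round1 expectation_bounded[OF expectation_bounded[OF act_bounded]]])
      show "\<bar>c - ?Z l0 / 6\<bar> \<le> \<bar>c\<bar> + real (card G) * (\<bar>2\<bar> + \<bar>- 1\<bar> + \<bar>1\<bar>)" for l0
        using Z_bounded[of l0] by linarith
    qed
    also have "\<dots> = c - measure_pmf.expectation ?p0 ?Z / 6"
      using Z_int by simp
    also have "measure_pmf.expectation ?p0 ?Z = (\<Sum>e\<in>G. 2 * measure_pmf.prob ?p0 {l0. edge_eliminated ?E1 (s1 l0) e}
              + (- 1) * measure_pmf.prob ?p0 {l0. touched ?E1 (s1 l0) e} + 1)"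
      by (rule expectation_sum_of_bool)
    finally have *: "measure_pmf.expectation ?p0 (\<lambda>l0. measure_pmf.expectation ?p1 (\<lambda>l1.
        measure_pmf.expectation ?p2 (\<lambda>l2. act (s3 l0 l1 l2))))
        \<le> c - (\<Sum>e\<in>G. 2 * measure_pmf.prob ?p0 {l0. edge_eliminated ?E1 (s1 l0) e}
              + (- 1) * measure_pmf.prob ?p0 {l0. touched ?E1 (s1 l0) e} + 1) / 6" .
    have "(\<Sum>e\<in>G. 1) \<le> (\<Sum>e\<in>G. 2 * measure_pmf.prob ?p0 {l0. edge_eliminated ?E1 (s1 l0) e}
              + (- 1) * measure_pmf.prob ?p0 {l0. touched ?E1 (s1 l0) e} + 1)"
    proof (rule sum_mono)
      fix e assume e: "e \<in> G"
      note e' = GD(1,2)[OF e]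
      show "1 \<le> 2 * measure_pmf.prob ?p0 {l0. edge_eliminated ?E1 (s1 l0) e}
              + (- 1) * measure_pmf.prob ?p0 {l0. touched ?E1 (s1 l0) e} + 1"
        using prob_touched_le[OF net(1) net(2) net(3) edge(3)[OF e']
            evolve0[OF e', where t = s and h = "[]", folded s1_def]]
        unfolding edge_eliminated_def by linarith
    qed
    then show ?thesis
      using * by simp
  qed
  \<comment> \<open>The bound is now \<open>card A\<close> plus 5/6 of \<open>card G\<close> plus
    2/3 of \<open>card (K \<inter> A)\<close>. Disjointness bounds the last two terms by 5/6 of
    \<open>card K\<close>.\<close>
  have "card G + card (K \<inter> A) = card (G \<union> K \<inter> A)"
    using finG finK by (intro card_Un_disjoint[symmetric]) (auto simp: G_def)
  also have "\<dots> \<le> card K"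
    using finK by (intro card_mono) (auto simp: G_def)
  finally have "real (card G) + real (card (K \<inter> A)) \<le> real (card K)"
    by linarith
  then show ?thesis
    using round0 unfolding expectation_run A_def[symmetric] K_def[symmetric] c_def by linarith
qed

end
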